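(* For every integer $s$, \[ \sum_{n=0}^\infty \frac{C_n}{4^{2n+1}}\frac{F_{2n+s}}{2n+1}=\frac{\pi}{10\sqrt5}(2L_{s-1}+F_{s-1}\sqrt5)+F_{s-2}\left(\sqrt{\alpha\sqrt5}-2\right)-\alpha^{s-2}\sqrt{\frac{-\beta^3}{\sqrt5}}, \] \[ \sum_{n=0}^\infty \frac{C_n}{4^{2n+1}}\frac{L_{2n+s}}{2n+1}=\frac{\pi}{10}(L_{s-1}+2F_{s-1}\sqrt5)+L_{s-2}\left(\sqrt{\alpha\sqrt5}-2\right)-\alpha^{s-2}\sqrt{-\beta^3\sqrt5}. \]
   Context: $C_n=\frac{1}{n+1}\binom{2n}{n}$ are the Catalan numbers. $\alpha=\frac{1+\sqrt5}{2}$, $\beta=\frac{1-\sqrt5}{2}$. The Fibonacci and Lucas numbers are defined for all integers $n$ by $F_n=\frac{\alpha^n-\beta^n}{\alpha-\beta}$ and $L_n=\alpha^n+\beta^n$. *)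

theory Defs
  imports Complex_Main
begin

definition catalan :: "nat \<Rightarrow> real" where
  "catalan n = 1 / (real n + 1) * real ((2 * n) choose n)"

definition alpha :: real where
  "alpha = (1 + sqrt 5) / 2"

definition beta :: real where
  "beta = (1 - sqrt 5) / 2"

text \<open>Fibonacci and Lucas numbers with arbitrary integer index, as real numbers,
  given by the Binet formulas; \<open>powi\<close> is the power with integer exponent.\<close>

definition fibonacci :: "int \<Rightarrow> real" where
  "fibonacci n = (alpha powi n - beta powi n) / (alpha - beta)"

definition lucas :: "int \<Rightarrow> real" where
  "lucas n = alpha powi n + beta powi n"

end

theory Submission
  imports Defs "HOL-Analysis.Generalised_Binomial_Theorem"
begin

text \<open>
  Integrating the Catalan generating function
  \<open>\<Sum> C\<^sub>n t\<^bsup>2n\<^esup> = 2 / (1 + sqrt (1 - 4t\<^sup>2))\<close> gives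
  \<open>\<Sum> C\<^sub>n t\<^bsup>2n+1\<^esup> / (2n+1) = arcsin (2t) - 2t / (1 + sqrt (1 - 4t\<^sup>2))\<close> for \<open>\<bar>t\<bar> < 1/2\<close>.
  By the Binet formulas both series are combinations of this one at \<open>t = \<alpha>/4\<close> and \<open>t = \<beta>/4\<close>,
  where \<open>arcsin (\<alpha>/2) = 3\<pi>/10\<close> and \<open>arcsin (\<beta>/2) = -\<pi>/10\<close>.
\<close>

section \<open>Power series with Catalan coefficients\<close>

text \<open>The ratio of consecutive Catalan numbers, multiplied out. Up to a factor -4 it is the
  ratio of consecutive binomial coefficients of exponent 1/2, which drives the next
  induction.\<close>

lemma catalan_Suc: "(real n + 2) * catalan (Suc n) = (4 * real n + 2) * catalan n"
proof -
  have "real (2 * Suc n choose Suc n) = fact (Suc (Suc (2 * n))) / (fact (Suc n) * fact (Suc n))"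
    by (subst binomial_fact) auto
  also have "\<dots> = (2 * real n + 2) * (2 * real n + 1) * fact (2 * n) / ((real n + 1)\<^sup>2 * (fact n * fact n))"
    by (simp add: power2_eq_square algebra_simps)
  also have "\<dots> = (4 * real n + 2) / (real n + 1) * (fact (2 * n) / (fact n * fact n))"
    by (simp add: divide_simps power2_eq_square) (simp add: algebra_simps)
  also have "fact (2 * n) / (fact n * fact n) = real (2 * n choose n)"
    by (subst binomial_fact) auto
  finally have binom: "real (2 * Suc n choose Suc n) = (4 * real n + 2) / (real n + 1) * real (2 * n choose n)" .
  have "real (Suc n) + 1 = real n + 2" "real n + 2 \<noteq> 0"
    by simp_all
  then show ?thesis
    by (simp only: catalan_def binom) simp
qed

text \<open>Coefficients of \<open>sqrt (1 - 4 * x)\<close> beyond the constant term: both sides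
  obey the same first-order recurrence in \<open>n\<close> and agree at 0.\<close>

lemma gbinomial_half_Suc: "((1/2) gchoose (Suc n)) * (-4) ^ Suc n = - 2 * catalan n"
proof (induction n)
  case 0
  show ?case by (simp add: catalan_def)
next
  case (Suc n)
  have rec: "(real n + 2) * ((1/2) gchoose Suc (Suc n)) = (1/2 - (real n + 1)) * ((1/2) gchoose Suc n)"
    using gbinomial_mult_1[of "1/2 :: real" "Suc n"] by (simp add: algebra_simps)
  have "(real n + 2) * (((1/2) gchoose Suc (Suc n)) * (-4) ^ Suc (Suc n))
      = ((real n + 2) * ((1/2) gchoose Suc (Suc n))) * ((-4) * (-4) ^ Suc n)"
    by simp
  also have "\<dots> = (4 * real n + 2) * (((1/2) gchoose Suc n) * (-4) ^ Suc n)"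
    unfolding rec by (simp add: algebra_simps)
  also have "\<dots> = (real n + 2) * (- 2 * catalan (Suc n))"
    using catalan_Suc[of n] unfolding Suc by (simp only: mult.left_commute)
  finally show ?case
    by (rule mult_left_cancel[THEN iffD1, rotated]) linarith
qed

text \<open>The binomial series reads \<open>sqrt (1 - 4 * x) = 1 - 2 * x * C x\<close> with
  \<open>C\<close> the generating function, so one drops the constant term and divides by
  \<open>- 2 * x\<close>. The rationalised closed form also makes sense at
  \<open>x = 0\<close>.\<close>

lemma catalan_generating_function:
  assumes "\<bar>x\<bar> < 1 / 4"
  shows "(\<lambda>n. catalan n * x ^ n) sums (2 / (1 + sqrt (1 - 4 * x)))"
proof (cases "x = 0")
  case True
  then show ?thesis
    using powser_sums_zero[of catalan] by (simp add: catalan_def)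
next
  case False
  have nonneg: "0 \<le> 1 - 4 * x" using assms by simp
  have "(\<lambda>n. ((1/2) gchoose n) * (- 4 * x) ^ n) sums sqrt (1 - 4 * x)"
    using sqrt_series[of "- 4 * x"] assms by simp
  then have "(\<lambda>n. ((1/2) gchoose Suc n) * (- 4 * x) ^ Suc n) sums (sqrt (1 - 4 * x) - 1)"
    by (subst sums_Suc_iff) simp
  moreover have term_eq: "((1/2) gchoose Suc n) * (- 4 * x) ^ Suc n = - 2 * x * (catalan n * x ^ n)" for n
  proof -
    have "((1/2) gchoose Suc n) * (- 4 * x) ^ Suc n = (((1/2) gchoose Suc n) * (- 4) ^ Suc n) * x ^ Suc n"
      by (simp only: power_mult_distrib mult.assoc)
    then show ?thesis
      unfolding gbinomial_half_Suc by simp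
  qed
  ultimately have "(\<lambda>n. - 2 * x * (catalan n * x ^ n)) sums (sqrt (1 - 4 * x) - 1)"
    by (simp only: term_eq)
  then have "(\<lambda>n. - 2 * x * (catalan n * x ^ n) / (- 2 * x)) sums ((sqrt (1 - 4 * x) - 1) / (- 2 * x))"
    by (rule sums_divide)
  moreover have "(sqrt (1 - 4 * x) - 1) / (- 2 * x) = 2 / (1 + sqrt (1 - 4 * x))"
  proof -
    define u where "u = sqrt (1 - 4 * x)"
    have u: "u * u = 1 - 4 * x" "1 + u \<noteq> 0"
      using nonneg real_sqrt_ge_zero[OF nonneg] unfolding u_def by (simp, linarith)
    have "(u - 1) * (1 + u) = 2 * (- 2 * x)"
      using u(1) by (simp add: algebra_simps)
    then have "(u - 1) / (- 2 * x) = 2 / (1 + u)"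
      using False u(2) by (subst frac_eq_eq) auto
    then show ?thesis by (simp add: u_def)
  qed
  ultimately show ?thesis
    using False by simp
qed

lemma catalan_even_series:
  assumes "\<bar>t\<bar> < 1 / 2"
  shows "(\<lambda>n. catalan n * t ^ (2 * n)) sums (2 / (1 + sqrt (1 - 4 * t\<^sup>2)))"
proof -
  have "t\<^sup>2 < (1/2)\<^sup>2"
    using assms by (intro power2_strict_mono) simp
  then show ?thesis
    using catalan_generating_function[of "t\<^sup>2"] by (simp add: power_mult power2_eq_square)
qed

section \<open>Term-by-term integration of the generating function\<close>

lemma DERIV_catalan_odd_sum:
  fixes t :: real
  assumes "\<bar>t\<bar> < 1 / 2"
  shows "DERIV (\<lambda>t. arcsin (2 * t) - 2 * t / (1 + sqrt (1 - 4 * t\<^sup>2))) t :> 2 / (1 + sqrt (1 - 4 * t\<^sup>2))"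
proof -
  define u where "u = sqrt (1 - 4 * t\<^sup>2)"
  have pos: "0 < 1 - 4 * t\<^sup>2"
    using power2_strict_mono[of t "1/2"] assms by (simp add: power2_eq_square)
  then have u: "0 < u" "u\<^sup>2 = 1 - 4 * t\<^sup>2" "4 * t\<^sup>2 = 1 - u\<^sup>2"
    by (simp_all add: u_def)
  have "DERIV (\<lambda>t. arcsin (2 * t) - 2 * t / (1 + sqrt (1 - 4 * t\<^sup>2))) t :>
      2 / u - (2 * (1 + u) + 8 * t\<^sup>2 / u) / (1 + u)\<^sup>2"
    using pos u(1) assms
    by (auto intro!: derivative_eq_intros simp: u_def[symmetric] power_mult_distrib)
       (simp add: field_simps power2_eq_square)
  moreover have "2 / u - (2 * (1 + u) + 8 * t\<^sup>2 / u) / (1 + u)\<^sup>2 = 2 / (1 + u)"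
  proof -
    \<comment> \<open>Factoring \<open>1 - u^2\<close> cancels one \<open>1 + u\<close>; what
      remains is \<open>2 / u - (2 / u) / (1 + u)\<close>.\<close>
    have t2: "8 * t\<^sup>2 = 2 * (1 - u) * (1 + u)"
      using u(3) by (simp add: algebra_simps power2_eq_square)
    have "1 + u \<noteq> 0" "u \<noteq> 0" using u(1) by simp_all
    then show ?thesis
      unfolding t2 by (simp add: divide_simps power2_eq_square) (simp add: algebra_simps)
  qed
  ultimately show ?thesis
    by (simp add: u_def)
qed

text \<open>The power series and the closed form have the same derivative on the interval and both
  vanish at 0.\<close>

lemma catalan_odd_series:
  assumes "\<bar>t\<bar> < 1 / 2"
  shows "(\<lambda>n. catalan n * t ^ (2 * n + 1) / real (2 * n + 1)) sums
    (arcsin (2 * t) - 2 * t / (1 + sqrt (1 - 4 * t\<^sup>2)))"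
proof -
  \<comment> \<open>Zeros pad the odd positions, giving a full power series that can be
    differentiated term by term; reindexing along \<open>2 * n\<close> removes them again.\<close>
  define f where "f n = (if even n then catalan (n div 2) / real (Suc n) else 0)" for n
  define F where "F = (\<lambda>x. \<Sum>n. f n * x ^ Suc n)"
  define G where "G = (\<lambda>t::real. arcsin (2 * t) - 2 * t / (1 + sqrt (1 - 4 * t\<^sup>2)))"
  have mono: "strict_mono (\<lambda>n::nat. 2 * n)"
    by (simp add: strict_mono_def)
  have vanish: "f n = 0" if "n \<notin> range (\<lambda>n. 2 * n)" for n
    using that by (auto simp: f_def elim: evenE)
  have f_even: "f (2 * n) = catalan n / real (2 * n + 1)" for n
    by (simp add: f_def)
  have deriv_sums: "(\<lambda>n. f n * real (Suc n) * x ^ n) sums (2 / (1 + sqrt (1 - 4 * x\<^sup>2)))"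
    if "\<bar>x\<bar> < 1 / 2" for x
  proof (subst sums_mono_reindex[OF mono, symmetric])
    have term_eq: "f (2 * n) * real (Suc (2 * n)) * x ^ (2 * n) = catalan n * x ^ (2 * n)" for n
      unfolding f_even by simp
    then show "(\<lambda>n. f (2 * n) * real (Suc (2 * n)) * x ^ (2 * n)) sums (2 / (1 + sqrt (1 - 4 * x\<^sup>2)))"
      using catalan_even_series[OF that] by (simp only: term_eq)
  qed (simp add: vanish)
  have DERIV_F: "DERIV F x :> 2 / (1 + sqrt (1 - 4 * x\<^sup>2))" if "\<bar>x\<bar> < 1 / 2" for x
    using DERIV_power_series'[of "1/2" f x] deriv_sums that
    by (force simp: F_def sums_iff)
  have "DERIV (\<lambda>x. F x - G x) x :> 0" if "\<bar>x\<bar> < 1 / 2" for x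
    using DERIV_diff[OF DERIV_F[OF that] DERIV_catalan_odd_sum[OF that]] by (simp add: G_def)
  then have "F t - G t = F 0 - G 0"
    using assms by (intro DERIV_isconst3[of "-1/2" "1/2"]) auto
  then have "F t = G t"
    by (simp add: F_def G_def)
  \<comment> \<open>\<open>F t = G t\<close> only concerns the value of \<open>suminf\<close>;
    convergence at \<open>t\<close> comes from comparison with the even series, whose terms are
    nonnegative.\<close>
  moreover have "summable (\<lambda>n. f n * t ^ Suc n)"
  proof -
    have "summable (\<lambda>n. norm (catalan n * t ^ (2 * n)))"
      using sums_summable[OF catalan_even_series[OF assms]]
      by (simp add: catalan_def power_mult abs_mult)
    then have "summable (\<lambda>n. catalan n / real (2 * n + 1) * t ^ (2 * n))"
    proof (rule summable_comparison_test'[where N = 0])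
      show "norm (catalan n / real (2 * n + 1) * t ^ (2 * n)) \<le> norm (catalan n * t ^ (2 * n))" for n
      proof -
        have "y / real (2 * n + 1) \<le> y" if "0 \<le> y" for y
          using that by (simp add: divide_le_eq mult_le_cancel_left1)
        from this[of "norm (catalan n * t ^ (2 * n))"] show ?thesis
          by (simp add: abs_mult)
      qed
    qed
    then have "summable (\<lambda>n. f (2 * n) * t ^ (2 * n) * t)"
      unfolding f_even by (rule summable_mult2)
    then show ?thesis
      using summable_mono_reindex[OF mono, of "\<lambda>n. f n * t ^ Suc n"] vanish
      by (simp add: mult_ac)
  qed
  ultimately have "(\<lambda>n. f n * t ^ Suc n) sums G t"
    by (simp add: F_def sums_iff)
  then have "(\<lambda>n. f (2 * n) * t ^ Suc (2 * n)) sums G t"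
    using sums_mono_reindex[OF mono, of "\<lambda>n. f n * t ^ Suc n"] vanish by simp
  then show ?thesis
    unfolding f_even by (simp add: G_def)
qed

lemma catalan_odd_series_quarter:
  assumes "x \<noteq> 0" "\<bar>x\<bar> < 2"
  shows "(\<lambda>n. catalan n / 4 ^ (2 * n + 1) * (x ^ (2 * n + 1) / real (2 * n + 1))) sums
    (arcsin (x / 2) - (2 - sqrt (4 - x\<^sup>2)) / x)"
proof -
  define u where "u = sqrt (4 - x\<^sup>2)"
  have "x\<^sup>2 < 2\<^sup>2"
    using assms(2) by (intro power2_strict_mono) simp
  then have u: "0 < u" "u * u = 4 - x * x"
    by (simp_all add: u_def flip: power2_eq_square)
  have "sqrt (1 - 4 * (x / 4)\<^sup>2) = sqrt ((4 - x\<^sup>2) / 4)"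
    by (rule arg_cong[of _ _ sqrt]) (simp add: field_simps power2_eq_square)
  then have "sqrt (1 - 4 * (x / 4)\<^sup>2) = u / 2"
    by (simp add: real_sqrt_divide u_def)
  \<comment> \<open>The left side is \<open>x / (2 + u)\<close>; expand by \<open>2 - u\<close> and
    use \<open>4 - u^2 = x^2\<close>.\<close>
  moreover have "2 * (x / 4) / (1 + u / 2) = (2 - u) / x"
    using u assms(1) by (simp add: field_simps)
  moreover have "\<bar>x / 4\<bar> < 1 / 2"
    using assms(2) by simp
  ultimately have "(\<lambda>n. catalan n * (x / 4) ^ (2 * n + 1) / real (2 * n + 1)) sums
      (arcsin (2 * (x / 4)) - (2 - u) / x)"
    using catalan_odd_series[of "x / 4"] by (simp only:)
  then show ?thesis
    by (simp add: u_def power_divide)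
qed

section \<open>Values at the golden ratio\<close>

lemma sqrt5_bounds: "2 < sqrt 5" "sqrt 5 < 3"
  by (rule real_less_rsqrt, simp, rule real_less_lsqrt, simp_all)

lemma alpha_beta_bounds: "0 < alpha" "alpha < 2" "beta < 0" "-2 < beta"
  using sqrt5_bounds by (auto simp: alpha_def beta_def)

lemma alpha_beta_relations:
  "alpha - beta = sqrt 5" "beta\<^sup>2 = beta + 1" "alpha * beta = -1"
  by (auto simp: alpha_def beta_def field_simps power2_eq_square)

text \<open>Since 3 and 2 tenths of \<open>pi\<close> add up to a right angle,
  \<open>cos (3 * (pi / 10)) = sin (2 * (pi / 10))\<close>. Dividing by \<open>c\<close> leaves a
  quadratic in \<open>s\<close> with roots \<open>- beta / 2\<close> and \<open>- alpha / 2\<close>,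
  of which only the first is positive.\<close>

lemma sin_pi_tenth: "sin (pi / 10) = - beta / 2"
proof -
  define s where "s = sin (pi / 10)"
  define c where "c = cos (pi / 10)"
  have s: "0 < s" unfolding s_def by (rule sin_gt_zero) auto
  have c: "0 < c" unfolding c_def by (rule cos_gt_zero) auto
  have c2: "c\<^sup>2 = 1 - s\<^sup>2"
    unfolding s_def c_def by (simp add: cos_squared_eq)
  have "cos (3 * (pi / 10)) = sin (2 * (pi / 10))"
    by (subst sin_cos_eq) (simp add: field_simps)
  then have "4 * c ^ 3 - 3 * c = 2 * s * c"
    unfolding cos_treble_cos sin_double s_def c_def .
  then have "c * (4 * c\<^sup>2 - 3) = c * (2 * s)"
    by (simp add: power2_eq_square power3_eq_cube algebra_simps)
  then have "4 * s\<^sup>2 + 2 * s = 1"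
    using c c2 by simp
  then have "(2 * s + beta) * (2 * s + alpha) = 0"
    by (simp add: alpha_def beta_def field_simps power2_eq_square)
  moreover have "2 * s + alpha > 0"
    using s alpha_beta_bounds(1) by simp
  ultimately show ?thesis
    by (simp add: s_def)
qed

lemma arcsin_beta_half: "arcsin (beta / 2) = - pi / 10"
proof (rule arcsin_unique)
  show "sin (- pi / 10) = beta / 2"
    using sin_pi_tenth by simp
qed (use pi_gt_zero in \<open>linarith+\<close>)

lemma arcsin_alpha_half: "arcsin (alpha / 2) = 3 * pi / 10"
proof (rule arcsin_unique)
  have "sin (3 * pi / 10) = cos (2 * (pi / 10))"
    by (subst cos_sin_eq) (simp add: field_simps)
  also have "\<dots> = 1 - 2 * (- beta / 2)\<^sup>2"
    by (simp only: cos_double_sin sin_pi_tenth)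
  also have "\<dots> = alpha / 2"
    by (simp add: alpha_def beta_def field_simps power2_eq_square)
  finally show "sin (3 * pi / 10) = alpha / 2" .
qed (use pi_gt_zero in \<open>linarith+\<close>)

text \<open>Both radicands equal \<open>(5 + sqrt 5) / 2\<close>.\<close>

lemma sqrt_four_minus_beta: "sqrt (4 - beta\<^sup>2) = sqrt (alpha * sqrt 5)"
  by (rule arg_cong[of _ _ sqrt]) (simp add: alpha_def beta_def field_simps power2_eq_square)

lemma sqrt_four_minus_alpha: "sqrt (4 - alpha\<^sup>2) = sqrt (alpha * sqrt 5) - sqrt (- (beta ^ 3) * sqrt 5)"
proof -
  \<comment> \<open>Since \<open>alpha = 1 / g\<^sup>2\<close>, the claim is \<open>g = 1 / g - g ^ 3\<close> times the fourth root of 5.\<close>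
  define g where "g = sqrt (- beta)"
  have g: "0 < g" "g\<^sup>2 = - beta"
    using alpha_beta_bounds by (auto simp: g_def)
  have "alpha = (1 / g)\<^sup>2"
    using g alpha_beta_relations(3) alpha_beta_bounds(3)
    by (simp add: power_divide field_simps)
  then have a: "sqrt alpha = 1 / g"
    using g(1) by (intro real_sqrt_unique) simp_all
  have "- (beta ^ 3) = (g ^ 3)\<^sup>2"
  proof -
    have "(g ^ 3)\<^sup>2 = (g\<^sup>2) ^ 3"
      by (simp only: power_mult[symmetric] mult.commute)
    then show ?thesis by (simp add: g(2))
  qed
  then have b: "sqrt (- (beta ^ 3)) = g ^ 3"
    using g(1) by (intro real_sqrt_unique) simp_all
  \<comment> \<open>In terms of \<open>beta = - g^2\<close> this is
    \<open>beta^2 = beta + 1\<close>.\<close>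
  have "1 - g ^ 4 = g\<^sup>2"
  proof -
    have "g ^ 4 = (g\<^sup>2)\<^sup>2" by simp
    also have "\<dots> = beta + 1"
      using g(2) alpha_beta_relations(2) by simp
    finally show ?thesis using g(2) by simp
  qed
  then have "1 / g - g ^ 3 = g"
    using g(1) by (simp add: field_simps power_numeral_reduce)
  moreover have "4 - alpha\<^sup>2 = - beta * sqrt 5"
    by (simp add: alpha_def beta_def field_simps power2_eq_square)
  then have "sqrt (4 - alpha\<^sup>2) = g * sqrt (sqrt 5)"
    by (simp only: real_sqrt_mult g_def)
  ultimately show ?thesis
    by (simp only: real_sqrt_mult a b left_diff_distrib[symmetric])
qed

section \<open>Passage to Fibonacci and Lucas numbers\<close>

text \<open>The shift by \<open>s\<close> only multiplies the odd series by
  \<open>x powi (s - 1)\<close>; the divisor \<open>x\<close> in its limit lowers the exponent to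
  \<open>s - 2\<close>.\<close>

lemma powi_shift_series:
  fixes s :: int
  assumes "x \<noteq> 0" "\<bar>x\<bar> < 2"
  shows "(\<lambda>n. catalan n / 4 ^ (2 * n + 1) * (x powi (2 * int n + s) / real (2 * n + 1))) sums
    (x powi (s - 1) * arcsin (x / 2) - x powi (s - 2) * (2 - sqrt (4 - x\<^sup>2)))"
proof -
  have "x powi (2 * int n + s) = x powi (s - 1) * x ^ (2 * n + 1)" for n
  proof -
    have "x powi (2 * int n + s) = x powi ((s - 1) + int (2 * n + 1))"
      by (simp add: algebra_simps)
    also have "\<dots> = x powi (s - 1) * x ^ (2 * n + 1)"
      using assms(1) by (subst power_int_add) (simp_all only: power_int_of_nat, simp)
    finally show ?thesis .
  qed
  then have term_eq: "catalan n / 4 ^ (2 * n + 1) * (x powi (2 * int n + s) / real (2 * n + 1)) =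
      x powi (s - 1) * (catalan n / 4 ^ (2 * n + 1) * (x ^ (2 * n + 1) / real (2 * n + 1)))" for n
    by simp
  have "x powi (s - 1) = x powi (s - 2) * x"
    using assms(1) power_int_add_1[of x "s - 2"] by simp
  then have limit_eq: "x powi (s - 1) * arcsin (x / 2) - x powi (s - 2) * (2 - sqrt (4 - x\<^sup>2)) =
      x powi (s - 1) * (arcsin (x / 2) - (2 - sqrt (4 - x\<^sup>2)) / x)"
    using assms(1) by (simp add: field_simps)
  show ?thesis
    unfolding term_eq limit_eq by (rule sums_mult[OF catalan_odd_series_quarter[OF assms]])
qed

theorem theorem4:
  fixes s :: int
  shows "(\<lambda>n. catalan n / 4 ^ (2 * n + 1) * (fibonacci (2 * int n + s) / real (2 * n + 1))) sums
           (pi / (10 * sqrt 5) * (2 * lucas (s - 1) + fibonacci (s - 1) * sqrt 5)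
             + fibonacci (s - 2) * (sqrt (alpha * sqrt 5) - 2)
             - alpha powi (s - 2) * sqrt (- (beta ^ 3) / sqrt 5)) \<and>
         (\<lambda>n. catalan n / 4 ^ (2 * n + 1) * (lucas (2 * int n + s) / real (2 * n + 1))) sums
           (pi / 10 * (lucas (s - 1) + 2 * fibonacci (s - 1) * sqrt 5)
             + lucas (s - 2) * (sqrt (alpha * sqrt 5) - 2)
             - alpha powi (s - 2) * sqrt (- (beta ^ 3) * sqrt 5))"
proof -
  define a where "a = alpha powi (s - 1)"
  define b where "b = beta powi (s - 1)"
  define a' where "a' = alpha powi (s - 2)"
  define b' where "b' = beta powi (s - 2)"
  define w where "w = sqrt (alpha * sqrt 5)"
  define v where "v = sqrt (- (beta ^ 3) * sqrt 5)"
  \<comment> \<open>\<open>A\<close> and \<open>B\<close> are the sums at \<open>alpha\<close> and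
    \<open>beta\<close>. Writing the radical at \<open>alpha\<close> as \<open>w - v\<close> lets
    both share \<open>w - 2\<close>, with \<open>- a' * v\<close> left over from \<open>A\<close>
    alone.\<close>
  define A where "A = a * (3 * pi / 10) - a' * (2 - (w - v))"
  define B where "B = b * (- pi / 10) - b' * (2 - w)"
  have alpha_series: "(\<lambda>n. catalan n / 4 ^ (2 * n + 1) * (alpha powi (2 * int n + s) / real (2 * n + 1))) sums A"
    using powi_shift_series[of alpha s] alpha_beta_bounds
    by (simp add: A_def a_def a'_def w_def v_def arcsin_alpha_half sqrt_four_minus_alpha)
  have beta_series: "(\<lambda>n. catalan n / 4 ^ (2 * n + 1) * (beta powi (2 * int n + s) / real (2 * n + 1))) sums B"
    using powi_shift_series[of beta s] alpha_beta_bounds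
    by (simp add: B_def b_def b'_def w_def arcsin_beta_half sqrt_four_minus_beta)
  have v: "sqrt (- (beta ^ 3) / sqrt 5) = v / sqrt 5"
  proof -
    have "- (beta ^ 3) / sqrt 5 = - (beta ^ 3) * sqrt 5 / 5"
      by (simp add: field_simps)
    then show ?thesis
      by (simp only: real_sqrt_divide v_def)
  qed
  have "(\<lambda>n. catalan n / 4 ^ (2 * n + 1) * (fibonacci (2 * int n + s) / real (2 * n + 1))) sums ((A - B) / sqrt 5)"
    using sums_divide[OF sums_diff[OF alpha_series beta_series], of "sqrt 5"]
    by (simp add: fibonacci_def alpha_beta_relations(1) diff_divide_distrib right_diff_distrib mult_ac)
  \<comment> \<open>The arcsine terms combine by \<open>3 * a + b = 2 * (a + b) + (a - b)\<close>. A
    general \<open>q\<close> replaces \<open>sqrt 5\<close> because the identity is purely rational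
    and does not use \<open>q^2 = 5\<close>.\<close>
  moreover have "(A - B) / q = pi / (10 * q) * (2 * (a + b) + (a - b) / q * q)
        + (a' - b') / q * (w - 2) - a' * (v / q)" if "q \<noteq> 0" for q
    using that by (simp add: A_def B_def) (simp add: field_simps)
  then have "(A - B) / sqrt 5 =
      pi / (10 * sqrt 5) * (2 * (a + b) + (a - b) / sqrt 5 * sqrt 5)
        + (a' - b') / sqrt 5 * (w - 2) - a' * (v / sqrt 5)"
    by simp
  moreover have "(\<lambda>n. catalan n / 4 ^ (2 * n + 1) * (lucas (2 * int n + s) / real (2 * n + 1))) sums (A + B)"
    using sums_add[OF alpha_series beta_series]
    by (simp add: lucas_def add_divide_distrib distrib_left)
  \<comment> \<open>Here the arcsine terms combine by
    \<open>3 * a - b = (a + b) + 2 * (a - b)\<close>.\<close>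
  moreover have "A + B = pi / 10 * ((a + b) + 2 * ((a - b) / sqrt 5) * sqrt 5) + (a' + b') * (w - 2) - a' * v"
    by (simp add: A_def B_def field_simps)
  ultimately show ?thesis
    unfolding v fibonacci_def lucas_def alpha_beta_relations(1)
      w_def[symmetric] v_def[symmetric] a_def[symmetric] b_def[symmetric] a'_def[symmetric] b'_def[symmetric]
    by simp
qed

end
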